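(* For arbitrarily large $N$, there is a set $A\subseteq \{1,\ldots,N\}$ with $|A|\geq N/2$ such that \[R_2(A)\leq 16\left(\frac{\log N}{\log\log N}\right)^2\] and \[C(A)\leq 24\left(\frac{\log N}{\log\log N}\right)^3.\]
   Context: A finite increasing sequence $a_1<\cdots<a_n$ is strictly convex if the sequence of first differences $a_{i+1}-a_i$ is strictly monotone; $C(B)$ denotes the length of the longest strictly convex sequence contained in $B$. For $L\geq 1$, a finite increasing sequence of real numbers $a_1<\cdots<a_n$ is called $L$-regular if there is a positive real number $X$ such that $X\leq a_{i+1}-a_i\leq LX$ for all $i=1,\ldots,n-1$. For a set $B$ of real numbers, $R_L(B)=\max\{|B'|:B'\subseteq B,\ B'\text{ is }L\text{-regular}\}$. *)

theory Defs
  imports Complex_Main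
begin

text \<open>Finite sequences are lists; a finite increasing sequence is a list \<open>xs\<close> with
  \<open>sorted_wrt (<) xs\<close>.\<close>

definition differences :: "real list \<Rightarrow> real list" where
  "differences xs = map (\<lambda>i. xs ! Suc i - xs ! i) [0..<length xs - 1]"

text \<open>``Strictly monotone'' allows strictly increasing as well as strictly decreasing
  differences.\<close>

definition strictly_convex :: "real list \<Rightarrow> bool" where
  "strictly_convex xs \<longleftrightarrow>
     sorted_wrt (<) xs \<and>
     (sorted_wrt (<) (differences xs) \<or> sorted_wrt (>) (differences xs))"

definition L_regular :: "real \<Rightarrow> real list \<Rightarrow> bool" where
  "L_regular L xs \<longleftrightarrow>
     sorted_wrt (<) xs \<and>
     (\<exists>X>0. \<forall>d\<in>set (differences xs). X \<le> d \<and> d \<le> L * X)"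

text \<open>The maxima below are meaningful for finite \<open>B\<close>: there they range over finite sets of
  numbers (nonempty because of the empty sequence). A finite set is identified with its
  increasing enumeration.\<close>

definition max_convex :: "real set \<Rightarrow> nat" where
  "max_convex B = Max {length xs | xs. set xs \<subseteq> B \<and> strictly_convex xs}"

definition max_regular :: "real \<Rightarrow> real set \<Rightarrow> nat" where
  "max_regular L B =
     Max {card B' | B'. B' \<subseteq> B \<and> finite B' \<and> L_regular L (sorted_list_of_set B')}"

end

theory Submission
  imports Defs "HOL-Real_Asymp.Real_Asymp"
begin

text \<open>Take \<open>N = b ^ k\<close> with \<open>b = 2 * k\<close>, and let \<open>A\<close> consist of the numbers below \<open>N\<close> all of whose
  base-\<open>b\<close> digits are nonzero, so that \<open>card A = (b - 1) ^ k \<ge> N / 2\<close>. Every multiple of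
  \<open>b ^ (j + 1)\<close> is followed by a gap of length \<open>b ^ j\<close>, so a sequence in \<open>A\<close> with steps at most
  \<open>b ^ j\<close> stays inside one block of length \<open>b ^ (j + 1)\<close>, and hence has at most \<open>b ^ 2\<close> steps larger
  than \<open>b ^ (j - 1)\<close>. A 2-regular sequence lives on essentially one such scale; in a convex sequence
  the steps up to \<open>b ^ j\<close> are consecutive, so each of the \<open>k\<close> scales contributes at most \<open>b ^ 2\<close>
  steps. Finally \<open>ln N / ln (ln N)\<close> is asymptotically \<open>k\<close>.\<close>

section \<open>Digit sets: their size and their gaps\<close>

definition nonzero_digits :: "nat \<Rightarrow> nat \<Rightarrow> nat set" where
  "nonzero_digits b k = {a. a < b ^ k \<and> (\<forall>j<k. a div b ^ j mod b \<noteq> 0)}"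

lemma finite_nonzero_digits: "finite (nonzero_digits b k)"
  by (rule finite_subset[of _ "{..<b ^ k}"]) (auto simp: nonzero_digits_def)

lemma nonzero_digits_Suc:
  assumes "a \<in> nonzero_digits b k" "0 < d" "d < b"
  shows "b * a + d \<in> nonzero_digits b (Suc k)"
proof -
  have "b * a + d < b * Suc a" using assms by simp
  also have "\<dots> \<le> b * b ^ k"
    using assms by (intro mult_le_mono2) (simp add: nonzero_digits_def)
  finally have "b * a + d < b ^ Suc k" by simp
  moreover have "(b * a + d) div b ^ j mod b \<noteq> 0" if "j < Suc k" for j
  proof (cases j)
    case (Suc i)
    then show ?thesis using assms that
      by (simp add: div_mult2_eq nonzero_digits_def)
  qed (use assms in simp)
  ultimately show ?thesis by (simp add: nonzero_digits_def)
qed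

text \<open>Appending a lowest digit from \<open>{0<..<b}\<close> is injective and keeps all digits
  nonzero, so each further digit multiplies the count by at least \<open>b - 1\<close>.\<close>

lemma card_nonzero_digits: "(b - 1) ^ k \<le> card (nonzero_digits b k)"
proof (induction k)
  case 0
  have "nonzero_digits b 0 = {0}" by (auto simp: nonzero_digits_def)
  then show ?case by simp
next
  case (Suc k)
  let ?g = "\<lambda>(a, d). b * a + d"
  let ?P = "nonzero_digits b k \<times> {0<..<b}"
  have "inj_on ?g ?P"
  proof (rule inj_onI, clarify)
    fix a d a' d' assume d: "d \<in> {0<..<b}" "d' \<in> {0<..<b}" and eq: "b * a + d = b * a' + d'"
    have "(b * a + d) div b = a" "(b * a' + d') div b = a'" using d by simp_all
    with eq have "a = a'" by metis
    with eq show "a = a' \<and> d = d'" by simp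
  qed
  then have "card ?P = card (?g ` ?P)" by (simp add: card_image)
  also have "\<dots> \<le> card (nonzero_digits b (Suc k))"
    by (intro card_mono finite_nonzero_digits) (auto intro: nonzero_digits_Suc)
  finally have "card (nonzero_digits b k) * (b - 1) \<le> card (nonzero_digits b (Suc k))"
    by (simp add: card_cartesian_product)
  moreover have "(b - 1) ^ Suc k \<le> card (nonzero_digits b k) * (b - 1)"
    using mult_le_mono1[OF Suc.IH, of "b - 1"] by (simp only: power_Suc2)
  ultimately show ?case by (rule order_trans[rotated])
qed

text \<open>Since digit \<open>j\<close> of \<open>a'\<close> is nonzero, \<open>a'\<close> lies at
  least \<open>b ^ j\<close> above the start of its block of length \<open>b ^ Suc j\<close>. Going
  back by at most \<open>b ^ j\<close> cannot leave the block.\<close>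

lemma nonzero_digits_same_block:
  assumes a': "a' \<in> nonzero_digits b k" and "a \<le> a'" "a' \<le> a + b ^ j"
  shows "a div b ^ Suc j = a' div b ^ Suc j"
proof (cases "j < k")
  case True
  have "a' div b ^ j mod b \<noteq> 0" using a' True by (simp add: nonzero_digits_def)
  then have "b ^ j \<le> b ^ j * (a' div b ^ j mod b)" by simp
  also have "\<dots> \<le> a' mod b ^ Suc j"
    using mod_mult2_eq[of a' "b ^ j" b] by (simp add: mult.commute)
  finally have "a' div b ^ Suc j * b ^ Suc j + b ^ j \<le> a'"
    using div_mult_mod_eq[of a' "b ^ Suc j"] by linarith
  then have le: "a' div b ^ Suc j * b ^ Suc j \<le> a" using assms(3) by linarith
  have "0 < b" using True a' by (cases "b = 0") (auto simp: nonzero_digits_def zero_power)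
  then have "a' div b ^ Suc j \<le> a div b ^ Suc j"
    using le by (metis less_eq_div_iff_mult_less_eq zero_less_power)
  with div_le_mono[OF \<open>a \<le> a'\<close>] show ?thesis by (simp add: le_antisym)
next
  \<comment> \<open>Beyond the top digit both numbers lie in block 0; for \<open>b = 0\<close> both
    quotients are divisions by 0, hence equal to 0.\<close>
  case False
  have lt: "a' < b ^ k" using a' by (simp add: nonzero_digits_def)
  show ?thesis
  proof (cases "b = 0")
    case False
    with \<open>\<not> j < k\<close> have "b ^ k \<le> b ^ Suc j" by (intro power_increasing) auto
    with lt \<open>a \<le> a'\<close> show ?thesis by simp
  qed simp
qed

section \<open>Counting steps at one scale\<close>

lemma nonzero_digits_span:
  assumes "0 < b" "p \<le> q"
    and "\<And>i. p \<le> i \<Longrightarrow> i \<le> q \<Longrightarrow> f i \<in> nonzero_digits b k"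
    and "\<And>i. p \<le> i \<Longrightarrow> i < q \<Longrightarrow> f i \<le> f (Suc i) \<and> f (Suc i) \<le> f i + b ^ j"
  shows "f q < f p + b ^ Suc j"
proof -
  have "f q div b ^ Suc j = f p div b ^ Suc j"
    using assms(2-)
  proof (induction q rule: dec_induct)
    case (step q)
    have "f q div b ^ Suc j = f (Suc q) div b ^ Suc j"
      using step by (intro nonzero_digits_same_block[where k = k]) auto
    with step show ?case by simp
  qed simp
  \<comment> \<open>The block start is at most \<open>f p\<close>, and the offset of
    \<open>f q\<close> within the block is less than the block length.\<close>
  then have "f q = f p div b ^ Suc j * b ^ Suc j + f q mod b ^ Suc j"
    by (metis div_mult_mod_eq)
  also have "\<dots> < f p + b ^ Suc j"
    using \<open>0 < b\<close> by (intro add_le_less_mono div_times_less_eq_dividend) simp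
  finally show ?thesis .
qed

lemma sum_steps:
  fixes f :: "nat \<Rightarrow> nat"
  assumes "p \<le> q" "\<And>i. p \<le> i \<Longrightarrow> i < q \<Longrightarrow> f i \<le> f (Suc i)"
  shows "f p + (\<Sum>i = p..<q. f (Suc i) - f i) = f q"
  using assms
proof (induction q rule: dec_induct)
  case (step q)
  have "f q \<le> f (Suc q)" using step.hyps step.prems by simp
  moreover have "f p + (\<Sum>i = p..<q. f (Suc i) - f i) = f q" using step.IH step.prems by simp
  ultimately show ?case using step.hyps by simp
qed simp

text \<open>The steps telescope to less than one block length \<open>b ^ Suc j\<close>, and each
  index in \<open>S\<close> uses up at least \<open>y\<close> of it. A real \<open>y\<close> lets
  the bound serve both powers of \<open>b\<close> and the real scale \<open>X\<close> of a regular
  sequence.\<close>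

lemma card_large_steps:
  assumes "0 < b" "p \<le> q"
    and mem: "\<And>i. p \<le> i \<Longrightarrow> i \<le> q \<Longrightarrow> f i \<in> nonzero_digits b k"
    and step: "\<And>i. p \<le> i \<Longrightarrow> i < q \<Longrightarrow> f i \<le> f (Suc i) \<and> f (Suc i) \<le> f i + b ^ j"
    and S: "S \<subseteq> {p..<q}" "\<And>i. i \<in> S \<Longrightarrow> y \<le> real (f (Suc i) - f i)"
  shows "real (card S) * y \<le> real b ^ Suc j"
proof -
  have "real (card S) * y \<le> (\<Sum>i\<in>S. real (f (Suc i) - f i))"
    using S(2) sum_bounded_below[of S y "\<lambda>i. real (f (Suc i) - f i)"] by simp
  also have "\<dots> \<le> (\<Sum>i = p..<q. real (f (Suc i) - f i))"
    using S(1) by (intro sum_mono2) auto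
  also have "\<dots> = real (\<Sum>i = p..<q. f (Suc i) - f i)" by simp
  also have "(\<Sum>i = p..<q. f (Suc i) - f i) \<le> b ^ Suc j"
    using sum_steps[of p q f] nonzero_digits_span[of b p q f k j] assms by fastforce
  finally show ?thesis by simp
qed

text \<open>At the least scale \<open>j\<close> with \<open>L * X \<le> b ^ j\<close> all steps fit,
  so \<open>m * X \<le> b ^ Suc j\<close>. Minimality gives \<open>b ^ (j - 1) < L * X\<close>, so
  the right side is below \<open>b ^ 2 * L * X\<close>, and \<open>X\<close> cancels.\<close>

lemma regular_steps_bound:
  fixes f :: "nat \<Rightarrow> nat" and L X :: real
  assumes "2 \<le> b" "1 \<le> L" "0 < X"
    and mem: "\<And>i. i \<le> m \<Longrightarrow> f i \<in> nonzero_digits b k"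
    and inc: "\<And>i. i < m \<Longrightarrow> f i < f (Suc i)"
    and reg: "\<And>i. i < m \<Longrightarrow> X \<le> real (f (Suc i) - f i) \<and> real (f (Suc i) - f i) \<le> L * X"
  shows "real m \<le> L * real b ^ 2"
proof -
  have "\<exists>j. L * X \<le> real b ^ j"
    using real_arch_pow[of "real b" "L * X"] \<open>2 \<le> b\<close> by (auto intro: less_imp_le)
  define j where "j = (LEAST j. L * X \<le> real b ^ j)"
  have j: "L * X \<le> real b ^ j"
    unfolding j_def by (rule LeastI_ex) fact
  have step: "f i \<le> f (Suc i) \<and> f (Suc i) \<le> f i + b ^ j" if "i < m" for i
  proof -
    have "real (f (Suc i) - f i) \<le> real b ^ j" using reg[OF that] j by linarith
    then have "f (Suc i) - f i \<le> b ^ j" by (metis of_nat_le_iff of_nat_power)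
    then show ?thesis using inc[OF that] by simp
  qed
  have count: "real m * y \<le> real b ^ Suc j"
    if "\<And>i. i < m \<Longrightarrow> y \<le> real (f (Suc i) - f i)" for y
    using card_large_steps[of b 0 m f k j "{0..<m}" y] that mem step \<open>2 \<le> b\<close> by simp
  show ?thesis
  proof (cases j)
    \<comment> \<open>There is no smaller scale to compare with; instead, steps between distinct
      naturals are at least 1.\<close>
    case 0
    have "1 \<le> real (f (Suc i) - f i)" if "i < m" for i using inc[OF that] by simp
    from count[OF this] have "real m \<le> real b" using 0 by simp
    also have "\<dots> \<le> 1 * real b ^ 2" using \<open>2 \<le> b\<close> by (simp add: power2_eq_square)
    also have "\<dots> \<le> L * real b ^ 2" using \<open>1 \<le> L\<close> by (intro mult_right_mono) auto
    finally show ?thesis .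
  next
    case (Suc i)
    then have "real b ^ i < L * X"
      using not_less_Least[of i "\<lambda>j. L * X \<le> real b ^ j"] by (simp add: j_def)
    then have "real b ^ 2 * real b ^ i \<le> real b ^ 2 * (L * X)"
      by (intro mult_left_mono) auto
    moreover have "real m * X \<le> real b ^ 2 * real b ^ i"
      using count[of X] reg Suc by (simp add: power2_eq_square mult.assoc)
    ultimately have "real m * X \<le> (L * real b ^ 2) * X" by (simp add: mult_ac)
    then show ?thesis using \<open>0 < X\<close> by simp
  qed
qed

text \<open>Quasiconvexity covers both increasing and decreasing differences: it is what makes the set of
  steps of size at most \<open>b ^ j\<close> an interval of indices.\<close>

lemma quasiconvex_steps_bound:
  fixes f :: "nat \<Rightarrow> nat"
  assumes "2 \<le> b"
    and mem: "\<And>i. i \<le> m \<Longrightarrow> f i \<in> nonzero_digits b k"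
    and inc: "\<And>i. i < m \<Longrightarrow> f i < f (Suc i)"
    and quasiconvex: "\<And>i l i'. i \<le> l \<Longrightarrow> l \<le> i' \<Longrightarrow> i' < m \<Longrightarrow>
      f (Suc l) - f l \<le> max (f (Suc i) - f i) (f (Suc i') - f i')"
  shows "m \<le> b + k * b ^ 2"
proof -
  define I where "I j = {i. i < m \<and> f (Suc i) - f i \<le> b ^ j}" for j
  have fin: "finite (I j)" for j by (simp add: I_def)
  have count: "real (card S) * y \<le> real b ^ Suc j"
    if S: "S \<subseteq> I j" "\<And>i. i \<in> S \<Longrightarrow> y \<le> real (f (Suc i) - f i)" for S y j
  proof (cases "I j = {}")
    case False
    \<comment> \<open>By quasiconvexity every step between the extreme indices \<open>p\<close> and
      \<open>q\<close> is also at most \<open>b ^ j\<close>, so the single-scale count applies to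
      \<open>{p..<Suc q}\<close>.\<close>
    define p q where "p = Min (I j)" and "q = Max (I j)"
    have pq: "p \<in> I j" "q \<in> I j" and between: "\<And>i. i \<in> I j \<Longrightarrow> p \<le> i \<and> i \<le> q"
      using False fin by (auto simp: p_def q_def)
    show ?thesis
    proof (rule card_large_steps)
      show "p \<le> Suc q" using pq between by (simp add: le_SucI)
      show "f i \<in> nonzero_digits b k" if "i \<le> Suc q" for i
        using that pq(2) mem by (simp add: I_def)
      show "f i \<le> f (Suc i) \<and> f (Suc i) \<le> f i + b ^ j" if "p \<le> i" "i < Suc q" for i
        using quasiconvex[of p i q] inc[of i] that pq by (auto simp: I_def)
      show "S \<subseteq> {p..<Suc q}" using S(1) between by (auto simp: less_Suc_eq_le)
    qed (use S \<open>2 \<le> b\<close> in auto)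
  qed (use S in simp)
  have "card (I j) \<le> b + j * b ^ 2" for j
  proof (induction j)
    case 0
    have "real (card (I 0)) * 1 \<le> real b ^ Suc 0"
      using inc by (intro count) (auto simp: I_def Suc_le_eq)
    then show ?case by simp
  next
    case (Suc j)
    let ?S = "I (Suc j) - I j"
    \<comment> \<open>Indices new at scale \<open>Suc j\<close> have steps above
      \<open>b ^ j\<close>, while the span is at most \<open>b ^ Suc (Suc j)\<close>; the two extra
      powers give \<open>b ^ 2\<close> per scale.\<close>
    have "real (card ?S) * real b ^ j \<le> real b ^ Suc (Suc j)"
    proof (rule count)
      fix i assume "i \<in> ?S"
      then have "b ^ j \<le> f (Suc i) - f i" by (auto simp: I_def)
      then show "real b ^ j \<le> real (f (Suc i) - f i)"
        by (metis of_nat_le_iff of_nat_power)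
    qed auto
    also have "\<dots> = real b ^ 2 * real b ^ j" by (simp add: power2_eq_square mult.assoc)
    finally have "real (card ?S) \<le> real b ^ 2" using \<open>2 \<le> b\<close> by simp
    then have "card ?S \<le> b ^ 2" by (metis of_nat_le_iff of_nat_power)
    moreover have "card (I (Suc j)) \<le> card (I j \<union> ?S)"
      by (intro card_mono) (auto simp: fin)
    ultimately show ?case using Suc card_Un_le[of "I j" ?S] by simp
  qed
  \<comment> \<open>All terms are below \<open>b ^ k\<close>, so no step exceeds that size and
    \<open>k\<close> scales exhaust the sequence.\<close>
  moreover have "I k = {..<m}"
  proof -
    have "f (Suc i) < b ^ k" if "i < m" for i
      using mem[of "Suc i"] that by (simp add: nonzero_digits_def)
    then show ?thesis by (fastforce simp: I_def)
  qed
  ultimately show ?thesis by (metis card_lessThan)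
qed

section \<open>Transfer to lists of reals and the two maxima\<close>

lemma set_differences: "set (differences xs) = {xs ! Suc i - xs ! i | i. i < length xs - 1}"
  by (auto simp: differences_def)

text \<open>An increasing list of differences is bounded by its right end, a decreasing one by its
  left end; the maximum treats both at once.\<close>

lemma differences_quasiconvex:
  assumes "sorted_wrt (<) (differences xs) \<or> sorted_wrt (>) (differences xs)"
    and "i \<le> l" "l \<le> i'" "i' < length xs - 1"
  shows "xs ! Suc l - xs ! l \<le> max (xs ! Suc i - xs ! i) (xs ! Suc i' - xs ! i')"
  using assms(1)
proof
  assume "sorted_wrt (<) (differences xs)"
  from sorted_wrt_nth_less[OF this, of l i'] assms(2-)
  show ?thesis by (cases "l = i'") (auto simp: differences_def)
next
  assume "sorted_wrt (>) (differences xs)"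
  from sorted_wrt_nth_less[OF this, of i l] assms(2-)
  show ?thesis by (cases "i = l") (auto simp: differences_def)
qed

text \<open>Pulls a list of reals back to naturals, where \<open>div\<close> and \<open>mod\<close>
  apply. Monotonicity makes truncated subtraction agree with the real differences.\<close>

lemma strict_sorted_nat_nth:
  assumes "sorted_wrt (<) xs" "set xs \<subseteq> real ` A" "xs \<noteq> []"
  obtains f :: "nat \<Rightarrow> nat" where
    "\<And>i. i \<le> length xs - 1 \<Longrightarrow> f i \<in> A \<and> xs ! i = real (f i)"
    "\<And>i. i < length xs - 1 \<Longrightarrow> f i < f (Suc i)"
    "\<And>i. i < length xs - 1 \<Longrightarrow> xs ! Suc i - xs ! i = real (f (Suc i) - f i)"
proof -
  have "\<forall>i. \<exists>a. i \<le> length xs - 1 \<longrightarrow> a \<in> A \<and> xs ! i = real a"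
  proof
    fix i
    show "\<exists>a. i \<le> length xs - 1 \<longrightarrow> a \<in> A \<and> xs ! i = real a"
    proof (cases "i \<le> length xs - 1")
      case True
      then have "i < length xs" using \<open>xs \<noteq> []\<close> by (cases xs) auto
      then have "xs ! i \<in> real ` A" using assms(2) nth_mem by blast
      then show ?thesis by blast
    qed simp
  qed
  then obtain f where f: "\<And>i. i \<le> length xs - 1 \<Longrightarrow> f i \<in> A \<and> xs ! i = real (f i)"
    by metis
  have less: "f i < f (Suc i)" if "i < length xs - 1" for i
    using sorted_wrt_nth_less[OF assms(1), of i "Suc i"] f[of i] f[of "Suc i"] that by auto
  show thesis
  proof (rule that[OF f less])
    show "xs ! Suc i - xs ! i = real (f (Suc i) - f i)" if "i < length xs - 1" for i
      using f[of i] f[of "Suc i"] less[OF that] that by (simp add: of_nat_diff)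
  qed
qed

lemma max_regular_nonzero_digits:
  assumes "2 \<le> b" "1 \<le> L"
  shows "real (max_regular L (real ` nonzero_digits b k)) \<le> L * real b ^ 2 + 1"
proof -
  let ?A = "real ` nonzero_digits b k"
  let ?M = "{card B' | B'. B' \<subseteq> ?A \<and> finite B' \<and> L_regular L (sorted_list_of_set B')}"
  have bound: "real (card B) \<le> L * real b ^ 2 + 1"
    if B: "B \<subseteq> ?A" "finite B" "L_regular L (sorted_list_of_set B)" for B
  proof (cases "B = {}")
    case False
    define xs where "xs = sorted_list_of_set B"
    have xs: "sorted_wrt (<) xs" "set xs \<subseteq> ?A" "xs \<noteq> []" "length xs = card B"
      using B False by (auto simp: xs_def)
    obtain X where X: "0 < X" "\<forall>d\<in>set (differences xs). X \<le> d \<and> d \<le> L * X"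
      using B(3) by (auto simp: L_regular_def xs_def)
    obtain f where f: "\<And>i. i \<le> length xs - 1 \<Longrightarrow> f i \<in> nonzero_digits b k \<and> xs ! i = real (f i)"
      "\<And>i. i < length xs - 1 \<Longrightarrow> f i < f (Suc i)"
      "\<And>i. i < length xs - 1 \<Longrightarrow> xs ! Suc i - xs ! i = real (f (Suc i) - f i)"
      using strict_sorted_nat_nth[OF xs(1-3)] by blast
    have "real (length xs - 1) \<le> L * real b ^ 2"
    proof (rule regular_steps_bound[OF assms X(1)])
      fix i assume i: "i < length xs - 1"
      then have "xs ! Suc i - xs ! i \<in> set (differences xs)" by (auto simp: set_differences)
      with X(2) f(3)[OF i]
      show "X \<le> real (f (Suc i) - f i) \<and> real (f (Suc i) - f i) \<le> L * X" by metis
    qed (use f in auto)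
    with xs(3,4) show ?thesis by (cases xs) auto
  qed (use assms in simp)
  \<comment> \<open>\<open>Max\<close> is attained only on a finite nonempty set; the empty sequence
    supplies the element 0. The \<open>+ 1\<close> in the bound passes from steps to terms.\<close>
  have "finite ?M"
    by (rule finite_subset[of _ "card ` Pow ?A"]) (auto simp: finite_nonzero_digits)
  moreover have "L_regular L (sorted_list_of_set {})"
    by (auto simp: L_regular_def differences_def intro: exI[of _ 1])
  then have "0 \<in> ?M" by force
  ultimately have "max_regular L ?A \<in> ?M"
    unfolding max_regular_def by (intro Max_in) auto
  with bound show ?thesis by auto
qed

lemma max_convex_nonzero_digits:
  assumes "2 \<le> b"
  shows "max_convex (real ` nonzero_digits b k) \<le> b + k * b ^ 2 + 1"
proof -
  let ?A = "real ` nonzero_digits b k"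
  let ?M = "{length xs | xs. set xs \<subseteq> ?A \<and> strictly_convex xs}"
  have bound: "length xs \<le> b + k * b ^ 2 + 1"
    if A: "set xs \<subseteq> ?A" and "strictly_convex xs" for xs
  proof (cases "xs = []")
    case False
    have xs: "sorted_wrt (<) xs"
      "sorted_wrt (<) (differences xs) \<or> sorted_wrt (>) (differences xs)"
      using that by (auto simp: strictly_convex_def)
    obtain f where f: "\<And>i. i \<le> length xs - 1 \<Longrightarrow> f i \<in> nonzero_digits b k \<and> xs ! i = real (f i)"
      "\<And>i. i < length xs - 1 \<Longrightarrow> f i < f (Suc i)"
      "\<And>i. i < length xs - 1 \<Longrightarrow> xs ! Suc i - xs ! i = real (f (Suc i) - f i)"
      using strict_sorted_nat_nth[OF xs(1) A False] by blast
    have "length xs - 1 \<le> b + k * b ^ 2"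
    proof (rule quasiconvex_steps_bound[OF assms])
      fix i l i' assume "i \<le> l" "l \<le> i'" "i' < length xs - 1"
      with differences_quasiconvex[OF xs(2) this] f(3)
      have "real (f (Suc l) - f l) \<le> max (real (f (Suc i) - f i)) (real (f (Suc i') - f i'))"
        by simp
      then show "f (Suc l) - f l \<le> max (f (Suc i) - f i) (f (Suc i') - f i')"
        by (simp only: of_nat_max[symmetric] of_nat_le_iff)
    qed (use f in auto)
    then show ?thesis by simp
  qed simp
  \<comment> \<open>\<open>?M\<close> collects lengths rather than lists, so the uniform bound
    itself yields finiteness.\<close>
  have "finite ?M"
    by (rule finite_subset[of _ "{..b + k * b ^ 2 + 1}"]) (use bound in auto)
  moreover have "strictly_convex []"
    by (simp add: strictly_convex_def differences_def)
  then have "length [] \<in> ?M" by (intro CollectI exI[of _ "[]"]) simp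
  ultimately have "max_convex ?A \<in> ?M"
    unfolding max_convex_def by (metis (no_types, lifting) Max_in empty_iff)
  with bound show ?thesis by auto
qed

section \<open>Density and the choice of \<open>N\<close>\<close>

text \<open>Base \<open>2 * k\<close> is chosen so that the density
  \<open>(1 - 1 / (2 * k)) ^ k\<close> is at least \<open>1 / 2\<close> by Bernoulli's
  inequality.\<close>

lemma card_nonzero_digits_half:
  assumes "0 < k"
  shows "real ((2 * k) ^ k) / 2 \<le> real (card (nonzero_digits (2 * k) k))"
proof -
  have "1 + real k * (- 1 / (2 * real k)) \<le> (1 + (- 1 / (2 * real k))) ^ k"
    using assms by (intro Bernoulli_inequality) (simp add: field_simps)
  then have "1 / 2 \<le> (1 - 1 / (2 * real k)) ^ k" using assms by simp
  then have "(2 * real k) ^ k * (1 / 2) \<le> (2 * real k) ^ k * (1 - 1 / (2 * real k)) ^ k"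
    by (intro mult_left_mono) auto
  also have "\<dots> = (2 * real k * (1 - 1 / (2 * real k))) ^ k"
    by (simp add: power_mult_distrib)
  also have "2 * real k * (1 - 1 / (2 * real k)) = real (2 * k - 1)"
    using assms by (simp add: field_simps of_nat_diff)
  also have "real (2 * k - 1) ^ k \<le> real (card (nonzero_digits (2 * k) k))"
    using card_nonzero_digits[of "2 * k" k] by (metis of_nat_le_iff of_nat_power)
  finally show ?thesis by simp
qed

theorem theorem6:
  "\<forall>N0::nat. \<exists>N\<ge>N0. \<exists>A\<subseteq>{1..N}.
     real (card A) \<ge> real N / 2 \<and>
     real (max_regular 2 (real ` A)) \<le> 16 * (ln (real N) / ln (ln (real N))) ^ 2 \<and>
     real (max_convex (real ` A)) \<le> 24 * (ln (real N) / ln (ln (real N))) ^ 3"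
proof
  fix N0 :: nat
  \<comment> \<open>This is \<open>ln N / ln (ln N)\<close> at \<open>N = (2 * x) ^ x\<close>. As
    \<open>r x\<close> is asymptotic to \<open>x\<close>, the leading terms to compare are
    \<open>8 * x ^ 2\<close> with \<open>16 * x ^ 2\<close> and \<open>4 * x ^ 3\<close> with
    \<open>24 * x ^ 3\<close>.\<close>
  define r where "r x = x * ln (2 * x) / ln (x * ln (2 * x))" for x :: real
  have "eventually (\<lambda>x. 2 * (2 * x) ^ 2 + 1 \<le> 16 * r x ^ 2) at_top"
    unfolding r_def by real_asymp
  moreover have "eventually (\<lambda>x. 2 * x + x * (2 * x) ^ 2 + 1 \<le> 24 * r x ^ 3) at_top"
    unfolding r_def by real_asymp
  ultimately have "eventually (\<lambda>x. 2 * (2 * x) ^ 2 + 1 \<le> 16 * r x ^ 2 \<and>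
      2 * x + x * (2 * x) ^ 2 + 1 \<le> 24 * r x ^ 3) at_top"
    by (rule eventually_conj)
  then have "eventually (\<lambda>k. 2 * (2 * real k) ^ 2 + 1 \<le> 16 * r k ^ 2 \<and>
      2 * real k + real k * (2 * real k) ^ 2 + 1 \<le> 24 * r k ^ 3) sequentially"
    by (rule eventually_compose_filterlim) (rule filterlim_real_sequentially)
  then obtain K where K: "\<And>k. K \<le> k \<Longrightarrow> 2 * (2 * real k) ^ 2 + 1 \<le> 16 * r k ^ 2 \<and>
      2 * real k + real k * (2 * real k) ^ 2 + 1 \<le> 24 * r k ^ 3"
    by (auto simp: eventually_sequentially)
  obtain k where k: "0 < k" "N0 \<le> k" "2 \<le> 2 * k" and "K \<le> k"
    by (rule that[of "Suc (max K N0)"]) auto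
  note bounds = K[OF \<open>K \<le> k\<close>]
  let ?N = "(2 * k) ^ k" and ?A = "nonzero_digits (2 * k) k"
  have ln: "ln (real ?N) = k * ln (2 * real k)"
    using k ln_realpow[of "2 * real k" k] by (simp only: of_nat_power of_nat_mult) simp
  have r: "ln (real ?N) / ln (ln (real ?N)) = r k"
    unfolding ln r_def by simp
  have "k < 2 ^ k" by (rule less_exp)
  also have "(2::nat) ^ k \<le> ?N" using k by (intro power_mono) auto
  finally have "N0 \<le> ?N" using k by simp
  moreover have "?A \<subseteq> {1..?N}"
  proof
    fix a assume a: "a \<in> ?A"
    \<comment> \<open>The nonzero lowest digit excludes \<open>a = 0\<close>, so \<open>?A\<close>
      starts at 1.\<close>
    then have "a div (2 * k) ^ 0 mod (2 * k) \<noteq> 0" and "a < ?N"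
      using k(1) unfolding nonzero_digits_def by blast+
    then show "a \<in> {1..?N}" by (cases a) simp_all
  qed
  moreover have "real ?N / 2 \<le> real (card ?A)"
    by (rule card_nonzero_digits_half) fact
  moreover have "real (max_regular 2 (real ` ?A)) \<le> 16 * r k ^ 2"
    using max_regular_nonzero_digits[of "2 * k" 2 k] k(3) bounds by simp
  moreover have "real (max_convex (real ` ?A)) \<le> 24 * r k ^ 3"
  proof -
    have "real (max_convex (real ` ?A)) \<le> real (2 * k + k * (2 * k) ^ 2 + 1)"
      using max_convex_nonzero_digits[OF k(3), of k] by (simp only: of_nat_le_iff)
    with bounds show ?thesis by simp
  qed
  ultimately show "\<exists>N\<ge>N0. \<exists>A\<subseteq>{1..N}.
     real (card A) \<ge> real N / 2 \<and>
     real (max_regular 2 (real ` A)) \<le> 16 * (ln (real N) / ln (ln (real N))) ^ 2 \<and>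
     real (max_convex (real ` A)) \<le> 24 * (ln (real N) / ln (ln (real N))) ^ 3"
    using r by metis
qed

end
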